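(* Let $k\in\mathbb N$. For every $S\subseteq R^k_{\{0,1\}}$ we have $\langle S\rangle_{\mathrm{qpp}}=\mathrm{EO}_6(S)=\mathrm{EO}_\wedge(\mathrm{EO}_5(S))$.
   Context: $E_k=\{1,\dots,k\}$. $R^k_{\{0,1\}}$ is the set of $k$-sorted relations on $\{0,1\}$: subsets of $\{0,1\}^n$ ($n\ge0$, viewed as predicates) with each variable assigned a sort in $E_k$. $\sigma_\bot$ is the empty $0$-ary relation and $\sigma^i_=$ equality on sort $i$. $\langle S\rangle_{\mathrm{qpp}}$ is the set of relations definable by formulas built from predicates in $S\cup\{\sigma_\bot,\sigma_=^1,\dots,\sigma_=^k\}$ using conjunction, existential and universal quantification only, each variable having one sort and substituted only into positions of that sort. A variable is dummy if the predicate does not depend on it. Elementary operations: (eo1) appending or removing a dummy variable; (eo2) permuting variables; (eo3) identifying the first two variables when they have the same sort; (eo4) composition: for $\rho_1,\rho_2$ whose first variables are non-dummy and of the same sort, $\rho'(x_1,\dots,x_{n-1},y_1,\dots,y_{m-1})=\exists z\,\rho_1(z,x_1,\dots,x_{n-1})\land\rho_2(z,y_1,\dots,y_{m-1})$; (eo5) $\rho'(x_1,\dots,x_{n-1})=\forall y\,\rho(y,x_1,\dots,x_{n-1})$; (eo6) conjunction of two $n$-ary relations whose $i$-th variables have the same sort for each $i$. $\mathrm{EO}_i(S)$ is the set of relations obtainable from elements of $S\cup\{\sigma_\bot,\sigma_=^1,\dots,\sigma_=^k\}$ by sequences of operations (eo1)–(eo$i$), and $\mathrm{EO}_\wedge(T)$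 is the set of relations obtainable from elements of $T$ by sequences of operations (eo6). *)

theory Defs
  imports Main "HOL-Combinatorics.Permutations"
begin

text \<open>A \<open>k\<close>-sorted relation on \<open>{0,1}\<close> is a pair: the list of the sorts of its variables, and the
  set of its tuples (the elements \<open>0\<close> and \<open>1\<close> are \<open>False\<close> and \<open>True\<close>).\<close>

type_synonym srel = "nat list \<times> bool list set"

definition srels :: "nat \<Rightarrow> srel set" where
  "srels k = {(ss, A). set ss \<subseteq> {1..k} \<and> (\<forall>a\<in>A. length a = length ss)}"

definition bot_rel :: srel where
  "bot_rel = ([], {})"

definition eq_rel :: "nat \<Rightarrow> srel" where
  "eq_rel i = ([i, i], {[b, b] | b. True})"

definition with_consts :: "nat \<Rightarrow> srel set \<Rightarrow> srel set" where
  "with_consts k S = S \<union> {bot_rel} \<union> eq_rel ` {1..k}"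


text \<open>A variable is a pair \<open>(sort, name)\<close>, so that each variable has exactly one sort and there are
  infinitely many variables of every sort. There is no constant for truth or falsity.\<close>

type_synonym var = "nat \<times> nat"

datatype formula =
    Atom srel "var list"
  | Conj formula formula
  | Exists var formula
  | Forall var formula

primrec free_vars :: "formula \<Rightarrow> var set" where
  "free_vars (Atom \<rho> xs) = set xs"
| "free_vars (Conj \<phi> \<psi>) = free_vars \<phi> \<union> free_vars \<psi>"
| "free_vars (Exists x \<phi>) = free_vars \<phi> - {x}"
| "free_vars (Forall x \<phi>) = free_vars \<phi> - {x}"

primrec well_sorted :: "nat \<Rightarrow> srel set \<Rightarrow> formula \<Rightarrow> bool" where
  "well_sorted k T (Atom \<rho> xs) \<longleftrightarrow> \<rho> \<in> T \<and> map fst xs = fst \<rho>"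
| "well_sorted k T (Conj \<phi> \<psi>) \<longleftrightarrow> well_sorted k T \<phi> \<and> well_sorted k T \<psi>"
| "well_sorted k T (Exists x \<phi>) \<longleftrightarrow> fst x \<in> {1..k} \<and> well_sorted k T \<phi>"
| "well_sorted k T (Forall x \<phi>) \<longleftrightarrow> fst x \<in> {1..k} \<and> well_sorted k T \<phi>"

primrec sat :: "(var \<Rightarrow> bool) \<Rightarrow> formula \<Rightarrow> bool" where
  "sat v (Atom \<rho> xs) \<longleftrightarrow> map v xs \<in> snd \<rho>"
| "sat v (Conj \<phi> \<psi>) \<longleftrightarrow> sat v \<phi> \<and> sat v \<psi>"
| "sat v (Exists x \<phi>) \<longleftrightarrow> (\<exists>b. sat (v(x := b)) \<phi>)"
| "sat v (Forall x \<phi>) \<longleftrightarrow> (\<forall>b. sat (v(x := b)) \<phi>)"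

text \<open>The relation \<open>\<rho>(x\<^sub>1,\<dots>,x\<^sub>n) = \<phi>\<close> for distinct variables \<open>xs = [x\<^sub>1,\<dots>,x\<^sub>n]\<close> that include all the
  free variables of \<open>\<phi>\<close>; those not occurring in \<open>\<phi>\<close> are dummy.\<close>

definition defined_rel :: "var list \<Rightarrow> formula \<Rightarrow> srel" where
  "defined_rel xs \<phi> = (map fst xs, {map v xs | v. sat v \<phi>})"

definition qpp :: "nat \<Rightarrow> srel set \<Rightarrow> srel set" where
  "qpp k S = {defined_rel xs \<phi> | xs \<phi>.
     well_sorted k (with_consts k S) \<phi> \<and> distinct xs \<and> fst ` set xs \<subseteq> {1..k} \<and>
     free_vars \<phi> \<subseteq> set xs}"


text \<open>Positions of variables are counted from \<open>0\<close>.\<close>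

definition dummy :: "nat \<Rightarrow> srel \<Rightarrow> bool" where
  "dummy i \<rho> \<longleftrightarrow> i < length (fst \<rho>) \<and>
     (\<forall>a b. length a = length (fst \<rho>) \<longrightarrow> (a[i := b] \<in> snd \<rho> \<longleftrightarrow> a \<in> snd \<rho>))"

definition remove_nth :: "nat \<Rightarrow> 'a list \<Rightarrow> 'a list" where
  "remove_nth i xs = take i xs @ drop (Suc i) xs"

text \<open>\<open>elem_op k j \<rho>s \<rho>\<close>: the operation (eo\<open>j\<close>) applied to the operands \<open>\<rho>s\<close> can yield \<open>\<rho>\<close>.\<close>

inductive elem_op :: "nat \<Rightarrow> nat \<Rightarrow> srel list \<Rightarrow> srel \<Rightarrow> bool" for k :: nat where
  append_dummy:
    "s \<in> {1..k} \<Longrightarrow> elem_op k 1 [(ss, A)] (ss @ [s], {a @ [b] | a b. a \<in> A})"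
| remove_dummy:
    "dummy i (ss, A) \<Longrightarrow> elem_op k 1 [(ss, A)] (remove_nth i ss, remove_nth i ` A)"
| permute:
    "\<pi> permutes {..<length ss} \<Longrightarrow>
     elem_op k 2 [(ss, A)] (permute_list \<pi> ss, permute_list \<pi> ` A)"
| identify:
    "elem_op k 3 [(s # s # ss, A)] (s # ss, {x # xs | x xs. x # x # xs \<in> A})"
| compose:
    "\<not> dummy 0 (s # ss, A) \<Longrightarrow> \<not> dummy 0 (s # ts, B) \<Longrightarrow>
     elem_op k 4 [(s # ss, A), (s # ts, B)]
       (ss @ ts, {xs @ ys | xs ys. \<exists>z. z # xs \<in> A \<and> z # ys \<in> B})"
| forall:
    "elem_op k 5 [(s # ss, A)] (ss, {xs. \<forall>y. y # xs \<in> A})"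
| conj:
    "elem_op k 6 [(ss, A), (ss, B)] (ss, A \<inter> B)"

inductive_set generated :: "nat \<Rightarrow> nat set \<Rightarrow> srel set \<Rightarrow> srel set"
  for k :: nat and J :: "nat set" and T :: "srel set" where
  base: "\<rho> \<in> T \<Longrightarrow> \<rho> \<in> generated k J T"
| step: "j \<in> J \<Longrightarrow> elem_op k j \<rho>s \<rho> \<Longrightarrow> (\<forall>\<sigma>\<in>set \<rho>s. \<sigma> \<in> generated k J T) \<Longrightarrow>
         \<rho> \<in> generated k J T"

definition EO :: "nat \<Rightarrow> nat \<Rightarrow> srel set \<Rightarrow> srel set" where
  "EO k i S = generated k {1..i} (with_consts k S)"

definition EO_conj :: "nat \<Rightarrow> srel set \<Rightarrow> srel set" where
  "EO_conj k T = generated k {6} T"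

end

theory Submission
  imports Defs
begin

text \<open>The only step with content is the existential quantifier: subsets of a two-element set have a
  common element as soon as any two of them, equal ones included, have one. Hence
  \<open>\<exists>z. \<rho>\<^sub>1 \<and> \<dots> \<and> \<rho>\<^sub>m\<close> is the conjunction of all \<open>\<exists>z. \<rho>\<^sub>i \<and> \<rho>\<^sub>j\<close>, and each of these is a
  composition (followed by identifications of variables) unless \<open>z\<close> is dummy in \<open>\<rho>\<^sub>i\<close> or \<open>\<rho>\<^sub>j\<close>.
  Universal quantifiers distribute over conjunctions. So the predicate of a formula is
  a conjunction of relations in \<open>EO\<^sub>5\<close>. Conversely, the elementary operations are
  definable by formulas; the renaming of variables this requires is expressed with the help of equality,
  as \<open>\<phi>[y/x] = (\<exists>x. x = y \<and> \<phi>)\<close>, which avoids any capture of bound variables.\<close>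

section \<open>Predicates on valuations\<close>

text \<open>Semantic counterpart of \<open>free_vars\<close>; it also applies to predicates for
  which no formula has been chosen.\<close>

definition depends_only :: "var set \<Rightarrow> ((var \<Rightarrow> bool) \<Rightarrow> bool) \<Rightarrow> bool" where
  "depends_only V P \<longleftrightarrow> (\<forall>v w. (\<forall>x\<in>V. v x = w x) \<longrightarrow> P v = P w)"

definition pred_rel :: "var list \<Rightarrow> ((var \<Rightarrow> bool) \<Rightarrow> bool) \<Rightarrow> srel" where
  "pred_rel xs P = (map fst xs, {map v xs | v. P v})"

lemma depends_onlyD: "depends_only V P \<Longrightarrow> (\<And>x. x \<in> V \<Longrightarrow> v x = w x) \<Longrightarrow> P v = P w"
  unfolding depends_only_def by blast

lemma depends_only_mono: "depends_only V P \<Longrightarrow> V \<subseteq> W \<Longrightarrow> depends_only W P"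
  unfolding depends_only_def by blast

lemma depends_only_upd: "depends_only V P \<Longrightarrow> x \<notin> V \<Longrightarrow> P (v(x := b)) = P v"
  by (rule depends_onlyD) auto

lemma depends_only_map: "depends_only (set xs) (\<lambda>v. map v xs \<in> A)"
  unfolding depends_only_def by (simp cong: map_cong)

lemma depends_only_sat: "depends_only (free_vars \<phi>) (\<lambda>v. sat v \<phi>)"
proof (induction \<phi>)
  case (Atom \<rho> xs)
  then show ?case by (simp add: depends_only_map)
next
  case (Conj \<phi> \<psi>)
  then show ?case unfolding depends_only_def by simp blast
next
  case (Exists x \<phi>)
  show ?case unfolding depends_only_def
  proof (intro allI impI)
    fix v w :: "var \<Rightarrow> bool"
    assume "\<forall>y\<in>free_vars (Exists x \<phi>). v y = w y"
    then have "sat (v(x := b)) \<phi> = sat (w(x := b)) \<phi>" for b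
      by (intro depends_onlyD[OF Exists]) auto
    then show "sat v (Exists x \<phi>) = sat w (Exists x \<phi>)" by simp
  qed
next
  case (Forall x \<phi>)
  show ?case unfolding depends_only_def
  proof (intro allI impI)
    fix v w :: "var \<Rightarrow> bool"
    assume "\<forall>y\<in>free_vars (Forall x \<phi>). v y = w y"
    then have "sat (v(x := b)) \<phi> = sat (w(x := b)) \<phi>" for b
      by (intro depends_onlyD[OF Forall]) auto
    then show "sat v (Forall x \<phi>) = sat w (Forall x \<phi>)" by simp
  qed
qed

lemma ex_valuation:
  assumes "distinct xs" "length a = length xs"
  shows "\<exists>v. map v xs = a"
proof
  show "map (\<lambda>x. the (map_of (zip xs a) x)) xs = a"
    using assms by (intro nth_equalityI) (auto simp: map_of_zip_nth)
qed

text \<open>A tuple may lie in the image because of another valuation with the same values on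
  \<open>xs\<close>; the dependency hypothesis makes both valuations equivalent for
  \<open>P\<close>.\<close>

lemma map_in_pred_rel: "depends_only (set xs) P \<Longrightarrow> map v xs \<in> snd (pred_rel xs P) \<longleftrightarrow> P v"
  unfolding pred_rel_def depends_only_def by auto

lemma pred_rel_map:
  assumes "distinct xs" "\<And>a. a \<in> A \<Longrightarrow> length a = length xs"
  shows "pred_rel xs (\<lambda>v. map v xs \<in> A) = (map fst xs, A)"
proof -
  have "\<exists>v. a = map v xs \<and> map v xs \<in> A" if "a \<in> A" for a
    using ex_valuation[OF assms(1) assms(2)[OF that]] that by metis
  then show ?thesis by (auto simp: pred_rel_def)
qed

text \<open>As \<open>xs\<close> is distinct, every tuple of the right length has the form
  \<open>map v xs\<close>, so testing these suffices. This is how the result of an elementary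
  operation is recognised as the relation of a predicate.\<close>

lemma pred_rel_eqI:
  assumes "distinct xs" "\<And>a. a \<in> A \<Longrightarrow> length a = length xs" "\<And>v. map v xs \<in> A \<longleftrightarrow> P v"
  shows "pred_rel xs P = (map fst xs, A)"
  using pred_rel_map[of xs A, OF assms(1,2)] assms(3) by simp

lemma Cons_in_pred_rel:
  assumes "x \<notin> set xs" "depends_only (set (x # xs)) P"
  shows "b # map v xs \<in> snd (pred_rel (x # xs) P) \<longleftrightarrow> P (v(x := b))"
proof -
  have "map (v(x := b)) (x # xs) = b # map v xs" using assms(1) by simp
  then show ?thesis using map_in_pred_rel[OF assms(2)] by metis
qed

lemma defined_rel_eq: "defined_rel xs \<phi> = pred_rel xs (\<lambda>v. sat v \<phi>)"
  by (simp add: defined_rel_def pred_rel_def)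

lemma fresh_vars:
  assumes "finite V"
  shows "\<exists>xs :: var list. distinct xs \<and> map fst xs = ss \<and> set xs \<inter> V = {}"
proof -
  obtain N where N: "\<forall>n \<in> snd ` V. n < N"
    using assms finite_nat_set_iff_bounded by blast
  \<comment> \<open>Names from \<open>N\<close> upwards are distinct and exceed all names in
    \<open>V\<close>, so the sorts can be prescribed freely.\<close>
  let ?xs = "zip ss [N..<N + length ss]"
  have "distinct ?xs" by (simp add: distinct_zipI2)
  moreover have "map fst ?xs = ss" by simp
  moreover have "x \<notin> V" if "x \<in> set ?xs" for x
  proof -
    have "snd x \<in> set [N..<N + length ss]" using that by (metis prod.collapse set_zip_rightD)
    then show ?thesis using N by fastforce
  qed
  ultimately show ?thesis by blast
qed

text \<open>The variables \<open>xs\<close> are replaced one at a time; \<open>us\<close> holds the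
  part already done. As \<open>xs\<close> is disjoint from \<open>zs\<close>, no replacement
  disturbs an earlier one, and \<open>zs\<close> may contain repetitions. \<open>F\<close> will be
  \<open>represented\<close> or \<open>expressible\<close>.\<close>

lemma replace_vars:
  fixes F :: "((var \<Rightarrow> bool) \<Rightarrow> bool) set"
  assumes subst: "\<And>P x y. P \<in> F \<Longrightarrow> fst x = fst y \<Longrightarrow> fst x \<in> K \<Longrightarrow> (\<lambda>v. P (v(x := v y))) \<in> F"
    and "map fst xs = map fst zs" "distinct xs" "fst ` set xs \<subseteq> K"
    and "set xs \<inter> (set us \<union> set zs) = {}"
    and "(\<lambda>v. map v (us @ xs) \<in> A) \<in> F"
  shows "(\<lambda>v. map v (us @ zs) \<in> A) \<in> F"
  using map_eq_imp_length_eq[OF assms(2)] assms(2-)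
proof (induction xs zs arbitrary: us rule: list_induct2)
  case Nil
  then show ?case by simp
next
  case (Cons x xs z zs)
  have "(\<lambda>v. map (v(x := v z)) (us @ x # xs) \<in> A) \<in> F"
    by (rule subst[OF Cons.prems(5), of x z]) (use Cons.prems(1,3) in auto)
  \<comment> \<open>\<open>x\<close> occurs neither in \<open>us\<close> nor in \<open>xs\<close>,
    so the update affects only the displayed occurrence.\<close>
  moreover have eq: "map (v(x := v z)) (us @ x # xs) = map v ((us @ [z]) @ xs)" for v :: "var \<Rightarrow> bool"
    using Cons.prems by auto
  ultimately have "(\<lambda>v. map v ((us @ [z]) @ xs) \<in> A) \<in> F" by (simp only: eq)
  then show ?case using Cons.IH[of "us @ [z]"] Cons.prems by auto
qed

section \<open>Relations closed under the first five operations\<close>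

text \<open>\<open>G\<close> stands for \<open>EO k 5 S\<close>.\<close>

locale op_closed =
  fixes k :: nat and G :: "srel set"
  assumes closed: "j \<in> {1..5} \<Longrightarrow> elem_op k j \<rho>s \<rho> \<Longrightarrow> set \<rho>s \<subseteq> G \<Longrightarrow> \<rho> \<in> G"
begin

section \<open>Changing the variable list of a relation\<close>

lemma pred_rel_permute:
  assumes "pred_rel xs P \<in> G" "distinct xs" "distinct ys" "set xs = set ys"
  shows "pred_rel ys P \<in> G"
proof -
  have "mset ys = mset xs" using assms by (simp add: set_eq_iff_mset_eq_distinct)
  then obtain \<pi> where \<pi>: "\<pi> permutes {..<length xs}" "permute_list \<pi> xs = ys"
    using mset_eq_permutation by blast
  have "map v ys = permute_list \<pi> (map v xs)" for v :: "var \<Rightarrow> bool"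
    using \<pi> by (simp add: permute_list_map)
  then have "pred_rel ys P
      = (permute_list \<pi> (map fst xs), permute_list \<pi> ` {map v xs | v. P v})"
    unfolding pred_rel_def using permute_list_map[OF \<pi>(1), of fst] \<pi>(2)
    by auto
  moreover have "elem_op k 2 [pred_rel xs P] \<dots>"
    unfolding pred_rel_def using \<pi> by (intro elem_op.permute) simp
  ultimately show ?thesis using closed[of 2 "[pred_rel xs P]"] assms(1) by simp
qed

lemma pred_rel_append:
  assumes "pred_rel xs P \<in> G" "depends_only (set xs) P" "distinct (xs @ ys)"
    "fst ` set ys \<subseteq> {1..k}"
  shows "pred_rel (xs @ ys) P \<in> G"
  using assms
proof (induction ys rule: rev_induct)
  case Nil
  then show ?case by simp
next
  case (snoc y ys)
  have dep: "depends_only (set (xs @ ys)) P"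
    using snoc.prems by (auto intro: depends_only_mono)
  have "pred_rel (xs @ ys @ [y]) P
      = (map fst (xs @ ys) @ [fst y], {a @ [b] | a b. a \<in> snd (pred_rel (xs @ ys) P)})"
    (is "?r = (_, ?B)")
  proof (rule pred_rel_eqI[THEN trans])
    show "map v (xs @ ys @ [y]) \<in> ?B \<longleftrightarrow> P v" for v
      using map_in_pred_rel[OF dep, of v] by auto
    show "length a = length (xs @ ys @ [y])" if "a \<in> ?B" for a
      using that by (auto simp: pred_rel_def)
  qed (use snoc.prems in auto)
  moreover have "elem_op k 1 [pred_rel (xs @ ys) P] \<dots>"
    using elem_op.append_dummy[of "fst y" k "map fst (xs @ ys)" "snd (pred_rel (xs @ ys) P)"] snoc.prems
    by (simp only: pred_rel_def) simp
  moreover have "pred_rel (xs @ ys) P \<in> G" using snoc by auto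
  ultimately show ?case using closed[of 1 "[pred_rel (xs @ ys) P]"] by simp
qed

lemma pred_rel_drop:
  assumes "pred_rel (ys @ xs) P \<in> G" "depends_only (set xs) P" "distinct (ys @ xs)"
  shows "pred_rel xs P \<in> G"
  using assms
proof (induction ys)
  case Nil
  then show ?case by simp
next
  case (Cons y ys)
  let ?r = "pred_rel (y # ys @ xs) P"
  have dep: "depends_only (set (ys @ xs)) P" "depends_only (set (y # ys @ xs)) P"
    using Cons.prems(2) by (auto intro: depends_only_mono)
  \<comment> \<open>Changing the first entry amounts to updating \<open>y\<close> in a valuation,
    and \<open>P\<close> does not depend on \<open>y\<close>.\<close>
  have "a[0 := b] \<in> snd ?r \<longleftrightarrow> a \<in> snd ?r" if a: "length a = length (y # ys @ xs)" for a b
  proof -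
    obtain v where v: "map v (y # ys @ xs) = a"
      using ex_valuation[OF _ a] Cons.prems by auto
    then have "a[0 := b] = map (v(y := b)) (y # ys @ xs)" using Cons.prems by auto
    then show ?thesis
      using v map_in_pred_rel[OF dep(2)] depends_only_upd[OF dep(1)] Cons.prems(3)
      by (metis append_Cons distinct.simps(2))
  qed
  then have "dummy 0 ?r" by (simp add: dummy_def pred_rel_def)
  moreover have "pred_rel (ys @ xs) P = (remove_nth 0 (map fst (y # ys @ xs)), remove_nth 0 ` snd ?r)"
    by (auto simp: pred_rel_def remove_nth_def image_def)
  ultimately have "pred_rel (ys @ xs) P \<in> G"
    using closed[OF _ elem_op.remove_dummy[of 0 "map fst (y # ys @ xs)" "snd ?r" k]] Cons.prems(1)
    by (simp add: pred_rel_def)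
  then show ?case using Cons by simp
qed

lemma pred_rel_change_vars:
  assumes "pred_rel xs P \<in> G" "depends_only (set xs) P" "distinct xs"
    and "depends_only (set ys) P" "distinct ys" "fst ` set ys \<subseteq> {1..k}"
  shows "pred_rel ys P \<in> G"
proof -
  let ?xs = "filter (\<lambda>x. x \<notin> set ys) xs" and ?ys = "filter (\<lambda>y. y \<notin> set xs) ys"
  have "pred_rel (xs @ ?ys) P \<in> G"
    using assms by (intro pred_rel_append) auto
  then have "pred_rel (?xs @ ys) P \<in> G"
    by (rule pred_rel_permute) (use assms in auto)
  then show ?thesis
    by (rule pred_rel_drop) (use assms in auto)
qed

section \<open>Predicates represented by relations in \<open>G\<close>\<close>

definition represented :: "((var \<Rightarrow> bool) \<Rightarrow> bool) set" where
  "represented = {P. \<exists>xs. distinct xs \<and> fst ` set xs \<subseteq> {1..k} \<and> depends_only (set xs) P \<and>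
     pred_rel xs P \<in> G}"

text \<open>The list chosen in \<open>represented\<close> is immaterial, by the change of
  variables.\<close>

lemma represented_pred_rel:
  assumes "P \<in> represented" "depends_only (set xs) P" "distinct xs" "fst ` set xs \<subseteq> {1..k}"
  shows "pred_rel xs P \<in> G"
  using assms pred_rel_change_vars unfolding represented_def by blast

text \<open>The operations act on leading variables; this supplies the remaining ones once those of
  \<open>V\<close> are placed in front.\<close>

lemma represented_split_vars:
  assumes "P \<in> represented"
  shows "\<exists>xs. distinct xs \<and> set xs \<inter> V = {} \<and> fst ` set xs \<subseteq> {1..k} \<and>
    depends_only (V \<union> set xs) P"
proof -
  obtain ys where ys: "distinct ys" "fst ` set ys \<subseteq> {1..k}" "depends_only (set ys) P"
    using assms(1) unfolding represented_def by blast
  let ?xs = "filter (\<lambda>x. x \<notin> V) ys"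
  have "depends_only (V \<union> set ?xs) P" using ys(3) by (rule depends_only_mono) auto
  then show ?thesis using ys by (intro exI[of _ ?xs]) auto
qed

lemma represented_Forall:
  assumes "P \<in> represented" "fst x \<in> {1..k}"
  shows "(\<lambda>v. \<forall>b. P (v(x := b))) \<in> represented"
proof -
  obtain xs where xs: "distinct (x # xs)" "fst ` set (x # xs) \<subseteq> {1..k}"
      and dep: "depends_only (set (x # xs)) P"
    using represented_split_vars[OF assms(1), of "{x}"] assms(2) by auto
  let ?A = "snd (pred_rel (x # xs) P)" and ?Q = "\<lambda>v. \<forall>b. P (v(x := b))"
  let ?B = "{a. \<forall>b. b # a \<in> ?A}"
  have A: "b # map v xs \<in> ?A \<longleftrightarrow> P (v(x := b))" for b v
    using xs(1) dep by (intro Cons_in_pred_rel) auto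
  \<comment> \<open>The fact \<open>A\<close> shows that \<open>?Q\<close> is determined by
    \<open>map v xs\<close>.\<close>
  have "depends_only (set xs) ?Q" unfolding depends_only_def
  proof (intro allI impI)
    fix v w :: "var \<Rightarrow> bool" assume "\<forall>y\<in>set xs. v y = w y"
    then have "map v xs = map w xs" by simp
    then show "?Q v = ?Q w" using A by metis
  qed
  moreover have "pred_rel xs ?Q = (map fst xs, ?B)"
    by (rule pred_rel_eqI) (use xs A in \<open>auto simp: pred_rel_def\<close>)
  moreover have "(map fst xs, ?B) \<in> G"
    using closed[OF _ elem_op.forall[of k "fst x" "map fst xs" ?A]]
      represented_pred_rel[OF assms(1) dep xs]
    by (simp add: pred_rel_def)
  ultimately show ?thesis unfolding represented_def using xs by auto
qed

text \<open>With \<open>x\<close> and \<open>y\<close> in front, the substitution is the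
  identification (eo3); for \<open>x = y\<close> nothing changes.\<close>

lemma represented_subst:
  assumes "P \<in> represented" "fst x = fst y" "fst x \<in> {1..k}"
  shows "(\<lambda>v. P (v(x := v y))) \<in> represented"
proof (cases "x = y")
  case True
  then show ?thesis using assms(1) by simp
next
  case False
  obtain xs where xs: "distinct (x # y # xs)" "fst ` set (x # y # xs) \<subseteq> {1..k}"
      and dep: "depends_only (set (x # y # xs)) P"
    using represented_split_vars[OF assms(1), of "{x, y}"] assms(2,3) False by auto
  let ?A = "snd (pred_rel (x # y # xs) P)" and ?Q = "\<lambda>v. P (v(x := v y))"
  let ?B = "{b # a | b a. b # b # a \<in> ?A}"
  have A: "v y # map v (y # xs) \<in> ?A \<longleftrightarrow> ?Q v" for v
    using xs(1) dep by (intro Cons_in_pred_rel) auto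
  have "depends_only (set (y # xs)) ?Q" unfolding depends_only_def
  proof (intro allI impI)
    fix v w :: "var \<Rightarrow> bool" assume "\<forall>z\<in>set (y # xs). v z = w z"
    then have "v y # map v (y # xs) = w y # map w (y # xs)" by simp
    then show "?Q v = ?Q w" using A by metis
  qed
  moreover have "pred_rel (y # xs) ?Q = (map fst (y # xs), ?B)"
  proof (rule pred_rel_eqI)
    show "map v (y # xs) \<in> ?B \<longleftrightarrow> ?Q v" for v using A[of v] by simp
  qed (use xs in \<open>auto simp: pred_rel_def\<close>)
  moreover have "(map fst (y # xs), ?B) \<in> G"
    using closed[OF _ elem_op.identify[of k "fst x" "map fst xs" ?A]]
      represented_pred_rel[OF assms(1) dep xs] assms(2)
    by (simp add: pred_rel_def)
  ultimately show ?thesis unfolding represented_def using xs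
    by (intro CollectI exI[of _ "y # xs"]) auto
qed

text \<open>\<open>zs\<close> may repeat variables, while \<open>represented\<close> asks for
  distinct ones. So the relation is first taken on fresh variables, and \<open>zs\<close> is
  substituted for them.\<close>

lemma represented_atom:
  assumes "(map fst zs, A) \<in> G" "\<And>a. a \<in> A \<Longrightarrow> length a = length zs" "fst ` set zs \<subseteq> {1..k}"
  shows "(\<lambda>v. map v zs \<in> A) \<in> represented"
proof -
  obtain xs :: "var list" where xs: "distinct xs" "map fst xs = map fst zs" "set xs \<inter> set zs = {}"
    using fresh_vars[of "set zs" "map fst zs"] by auto
  have xs_k: "fst ` set xs \<subseteq> {1..k}" using assms(3) xs(2) by (metis set_map)
  have len: "length xs = length zs" using xs(2) by (rule map_eq_imp_length_eq)
  have "(\<lambda>v. map v xs \<in> A) \<in> represented"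
    unfolding represented_def using xs xs_k assms len
    by (auto simp: pred_rel_map depends_only_map intro!: exI[of _ xs])
  then show ?thesis
    using replace_vars[of represented "{1..k}" xs zs "[]" A] represented_subst xs xs_k by auto
qed

text \<open>The two inequalities say that \<open>P\<close> and \<open>Q\<close> really depend on
  \<open>x\<close>, so that \<open>x\<close> is not dummy, as (eo4) demands.\<close>

lemma represented_compose:
  assumes P: "P \<in> represented" "P (v1(x := b1)) \<noteq> P v1"
    and Q: "Q \<in> represented" "Q (v2(x := b2)) \<noteq> Q v2"
    and x: "fst x \<in> {1..k}"
  shows "(\<lambda>v. \<exists>b. P (v(x := b)) \<and> Q (v(x := b))) \<in> represented"
proof -
  have nondummy: "\<not> dummy 0 (pred_rel (x # xs) R)"
    if "R (v(x := b)) \<noteq> R v" "distinct (x # xs)" and dep: "depends_only (set (x # xs)) R"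
    for R v b xs
  proof
    assume "dummy 0 (pred_rel (x # xs) R)"
    then have "length (map v (x # xs)) = length (fst (pred_rel (x # xs) R)) \<longrightarrow>
        ((map v (x # xs))[0 := b] \<in> snd (pred_rel (x # xs) R)
        \<longleftrightarrow> map v (x # xs) \<in> snd (pred_rel (x # xs) R))"
      unfolding dummy_def by blast
    then have "b # map v xs \<in> snd (pred_rel (x # xs) R)
        \<longleftrightarrow> map v (x # xs) \<in> snd (pred_rel (x # xs) R)" by (simp add: pred_rel_def)
    then show False using map_in_pred_rel[OF dep] Cons_in_pred_rel[OF _ dep] that(1,2) by simp
  qed
  obtain xs where xs: "distinct (x # xs)" "fst ` set (x # xs) \<subseteq> {1..k}"
      "depends_only (set (x # xs)) P"
    using represented_split_vars[OF P(1), of "{x}"] x by auto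
  obtain ys where ys: "distinct (x # ys)" "fst ` set (x # ys) \<subseteq> {1..k}"
      "depends_only (set (x # ys)) Q"
    using represented_split_vars[OF Q(1), of "{x}"] x by auto
  let ?A = "snd (pred_rel (x # xs) P)" and ?B = "snd (pred_rel (x # ys) Q)"
  let ?C = "{as @ bs | as bs. \<exists>z. z # as \<in> ?A \<and> z # bs \<in> ?B}"
  have "elem_op k 4 [(fst x # map fst xs, ?A), (fst x # map fst ys, ?B)] (map fst xs @ map fst ys, ?C)"
    using nondummy[OF P(2) xs(1,3)] nondummy[OF Q(2) ys(1,3)]
    by (intro elem_op.compose) (auto simp: pred_rel_def)
  then have "(map fst (xs @ ys), ?C) \<in> G"
    using closed[of 4] represented_pred_rel[OF P(1) xs(3,1,2)] represented_pred_rel[OF Q(1) ys(3,1,2)]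
    by (auto simp: pred_rel_def)
  \<comment> \<open>\<open>xs\<close> and \<open>ys\<close> may overlap;
    \<open>represented_atom\<close> makes the necessary identifications.\<close>
  then have "(\<lambda>v. map v (xs @ ys) \<in> ?C) \<in> represented"
    by (rule represented_atom) (use xs ys in \<open>auto simp: pred_rel_def\<close>)
  moreover have "map v (xs @ ys) \<in> ?C \<longleftrightarrow> (\<exists>b. P (v(x := b)) \<and> Q (v(x := b)))" for v
  proof -
    have "map v (xs @ ys) \<in> ?C \<longleftrightarrow> (\<exists>z. z # map v xs \<in> ?A \<and> z # map v ys \<in> ?B)"
    proof
      assume "map v (xs @ ys) \<in> ?C"
      then obtain as bs z where *: "map v xs @ map v ys = as @ bs" "z # as \<in> ?A" "z # bs \<in> ?B"
        by auto
      \<comment> \<open>Tuples in \<open>?A\<close> have a fixed length, so both splittings of the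
        list coincide.\<close>
      then have "length as = length xs" by (auto simp: pred_rel_def)
      then show "\<exists>z. z # map v xs \<in> ?A \<and> z # map v ys \<in> ?B" using * by auto
    qed auto
    then show ?thesis using Cons_in_pred_rel[OF _ xs(3)] Cons_in_pred_rel[OF _ ys(3)] xs(1) ys(1) by simp
  qed
  ultimately show ?thesis by simp
qed

section \<open>Conjunctions of represented predicates\<close>

text \<open>Empty conjunctions must be excluded: for \<open>k = 0\<close> truth need not be definable.\<close>

definition conj_represented :: "var set \<Rightarrow> ((var \<Rightarrow> bool) \<Rightarrow> bool) \<Rightarrow> bool" where
  "conj_represented V P \<longleftrightarrow> (\<exists>\<P>. finite \<P> \<and> \<P> \<noteq> {} \<and> \<P> \<subseteq> represented \<and>
     (\<forall>p\<in>\<P>. depends_only V p) \<and> (\<forall>v. P v \<longleftrightarrow> (\<forall>p\<in>\<P>. p v)))"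

lemma conj_represented_mono:
  assumes "conj_represented V P" "V \<subseteq> W"
  shows "conj_represented W P"
proof -
  obtain \<P> where "finite \<P>" "\<P> \<noteq> {}" "\<P> \<subseteq> represented" "\<forall>p\<in>\<P>. depends_only V p"
      "\<forall>v. P v \<longleftrightarrow> (\<forall>p\<in>\<P>. p v)"
    using assms unfolding conj_represented_def by auto
  then show ?thesis unfolding conj_represented_def
    by (intro exI[of _ \<P>]) (auto intro: depends_only_mono[OF _ assms(2)])
qed

lemma conj_represented_Conj:
  assumes "conj_represented V P" "conj_represented W Q"
  shows "conj_represented (V \<union> W) (\<lambda>v. P v \<and> Q v)"
proof -
  obtain \<P> \<Q> where "finite \<P>" "\<P> \<noteq> {}" "\<P> \<subseteq> represented" "\<forall>p\<in>\<P>. depends_only V p"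
      "\<forall>v. P v \<longleftrightarrow> (\<forall>p\<in>\<P>. p v)"
      "finite \<Q>" "\<Q> \<subseteq> represented" "\<forall>p\<in>\<Q>. depends_only W p" "\<forall>v. Q v \<longleftrightarrow> (\<forall>p\<in>\<Q>. p v)"
    using assms unfolding conj_represented_def by auto
  then show ?thesis unfolding conj_represented_def
    by (intro exI[of _ "\<P> \<union> \<Q>"]) (auto intro: depends_only_mono)
qed

lemma conj_represented_Forall:
  assumes "conj_represented V P" "fst x \<in> {1..k}"
  shows "conj_represented (V - {x}) (\<lambda>v. \<forall>b. P (v(x := b)))"
proof -
  obtain \<P> where \<P>: "finite \<P>" "\<P> \<noteq> {}" "\<P> \<subseteq> represented" "\<forall>p\<in>\<P>. depends_only V p"
      "\<forall>v. P v \<longleftrightarrow> (\<forall>p\<in>\<P>. p v)"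
    using assms unfolding conj_represented_def by auto
  let ?all = "\<lambda>p (v :: var \<Rightarrow> bool). \<forall>b. p (v(x := b))"
  have "depends_only (V - {x}) (?all p)" if "p \<in> \<P>" for p
    unfolding depends_only_def
  proof (intro allI impI)
    fix v w :: "var \<Rightarrow> bool" assume "\<forall>y\<in>V - {x}. v y = w y"
    then have "p (v(x := b)) = p (w(x := b))" for b
      using \<P>(4) that by (intro depends_onlyD[of V p]) auto
    then show "?all p v = ?all p w" by simp
  qed
  moreover have "?all p \<in> represented" if "p \<in> \<P>" for p
    using represented_Forall[OF _ assms(2)] \<P>(3) that by blast
  ultimately show ?thesis unfolding conj_represented_def using \<P>(1,2,5)
    by (intro exI[of _ "?all ` \<P>"]) auto
qed

text \<open>Conjuncts independent of \<open>x\<close> are moved out of the quantifier; the others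
  are combined in pairs by composition.\<close>

lemma conj_represented_Exists:
  assumes "conj_represented V P" "fst x \<in> {1..k}"
  shows "conj_represented (V - {x}) (\<lambda>v. \<exists>b. P (v(x := b)))"
proof -
  obtain \<P> where \<P>: "finite \<P>" "\<P> \<noteq> {}" "\<P> \<subseteq> represented" "\<forall>p\<in>\<P>. depends_only V p"
      "\<forall>v. P v \<longleftrightarrow> (\<forall>p\<in>\<P>. p v)"
    using assms unfolding conj_represented_def by auto
  \<comment> \<open>The conjuncts that depend on \<open>x\<close>, hence those to which
    \<open>represented_compose\<close> applies.\<close>
  define N where "N = {p \<in> \<P>. \<exists>v b. p (v(x := b)) \<noteq> p v}"
  define ex2 where "ex2 = (\<lambda>p q (v :: var \<Rightarrow> bool). \<exists>b. p (v(x := b)) \<and> q (v(x := b)))"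
  \<comment> \<open>Pairs of equal members are included: if \<open>N = {p}\<close>, then
    \<open>p\<close> survives only as \<open>ex2 p p\<close>.\<close>
  define \<Q> where "\<Q> = (\<P> - N) \<union> (\<lambda>(p, q). ex2 p q) ` (N \<times> N)"
  have N_sub: "N \<subseteq> \<P>" unfolding N_def by blast
  have indep: "p (v(x := b)) = p v" if "p \<in> \<P> - N" for p v b
    using that unfolding N_def by blast
  have "finite \<Q>" unfolding \<Q>_def using \<P>(1) N_sub finite_subset by blast
  \<comment> \<open>If \<open>N\<close> is empty, all of \<open>\<P>\<close> remains; otherwise
    there is a pair.\<close>
  moreover have "\<Q> \<noteq> {}" unfolding \<Q>_def using \<P>(2) by auto
  moreover have "\<Q> \<subseteq> represented"
  proof -
    have "ex2 p q \<in> represented" if "p \<in> N" "q \<in> N" for p q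
      using that represented_compose assms(2) \<P>(3) unfolding N_def ex2_def by blast
    then show ?thesis unfolding \<Q>_def using \<P>(3) by auto
  qed
  moreover have "depends_only (V - {x}) p" if "p \<in> \<Q>" for p
    unfolding depends_only_def
  proof (intro allI impI)
    fix v w :: "var \<Rightarrow> bool" assume vw: "\<forall>y\<in>V - {x}. v y = w y"
    have upd: "q (v(x := b)) = q (w(x := b))" if "q \<in> \<P>" for q b
      using vw \<P>(4) that by (intro depends_onlyD[of V q]) auto
    show "p v = p w"
    proof (cases "p \<in> \<P> - N")
      case True
      then show ?thesis using upd indep by blast
    next
      case False
      then obtain q r where "q \<in> \<P>" "r \<in> \<P>" "p = ex2 q r"
        using \<open>p \<in> \<Q>\<close> N_sub unfolding \<Q>_def by auto
      then show ?thesis unfolding ex2_def using upd by metis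
    qed
  qed
  moreover have "(\<exists>b. P (v(x := b))) \<longleftrightarrow> (\<forall>p\<in>\<Q>. p v)" for v
  proof
    assume "\<exists>b. P (v(x := b))"
    then obtain b where "\<forall>p\<in>\<P>. p (v(x := b))" using \<P>(5) by blast
    then show "\<forall>p\<in>\<Q>. p v"
      using indep N_sub unfolding \<Q>_def ex2_def by blast
  next
    assume Q: "\<forall>p\<in>\<Q>. p v"
    have dum: "p (v(x := b))" if "p \<in> \<P> - N" for p b
      using Q that indep unfolding \<Q>_def by blast
    have "\<exists>b. p (v(x := b)) \<and> q (v(x := b))" if "p \<in> N" "q \<in> N" for p q
      using Q that unfolding \<Q>_def ex2_def by auto
    \<comment> \<open>If \<open>False\<close> were excluded by some \<open>p\<close> and
      \<open>True\<close> by some \<open>q\<close> in \<open>N\<close>, then \<open>p\<close> and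
      \<open>q\<close> would have no common value.\<close>
    then have "\<exists>b. \<forall>p\<in>N. p (v(x := b))" by (smt (verit, best))
    then obtain b where "\<forall>p\<in>N. p (v(x := b))" ..
    then have "\<forall>p\<in>\<P>. p (v(x := b))" using dum by blast
    then show "\<exists>b. P (v(x := b))" using \<P>(5) by blast
  qed
  ultimately show ?thesis unfolding conj_represented_def by blast
qed

text \<open>A normal form for formulas. The free variables are tracked so that all conjuncts can
  later be placed on one common list.\<close>

lemma conj_represented_sat:
  assumes "T \<subseteq> G" "T \<subseteq> srels k" "well_sorted k T \<phi>"
  shows "conj_represented (free_vars \<phi>) (\<lambda>v. sat v \<phi>)"
  using assms(3)
proof (induction \<phi>)
  case (Atom \<rho> xs)
  obtain ss A where \<rho>: "\<rho> = (ss, A)" by (cases \<rho>)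
  have *: "(map fst xs, A) \<in> G" "(map fst xs, A) \<in> srels k" using Atom assms \<rho> by auto
  then have "(\<lambda>v. map v xs \<in> A) \<in> represented"
    by (intro represented_atom) (auto simp: srels_def)
  then show ?case unfolding conj_represented_def \<rho>
    by (intro exI[of _ "{\<lambda>v. map v xs \<in> A}"]) (auto simp: depends_only_map)
next
  case (Conj \<phi> \<psi>)
  then show ?case using conj_represented_Conj by simp
next
  case (Exists x \<phi>)
  then show ?case using conj_represented_Exists[of _ _ x] by simp
next
  case (Forall x \<phi>)
  then show ?case using conj_represented_Forall[of _ _ x] by simp
qed

text \<open>Each conjunct depends only on \<open>set xs\<close>, hence gives a relation in
  \<open>G\<close> on the same list \<open>xs\<close>, and (eo6) intersects these one by
  one.\<close>

lemma pred_rel_EO_conj: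
  assumes "conj_represented (set xs) P" "distinct xs" "fst ` set xs \<subseteq> {1..k}"
  shows "pred_rel xs P \<in> EO_conj k G"
proof -
  obtain \<P> where \<P>: "finite \<P>" "\<P> \<noteq> {}" "\<P> \<subseteq> represented" "\<forall>p\<in>\<P>. depends_only (set xs) p"
      "\<forall>v. P v \<longleftrightarrow> (\<forall>p\<in>\<P>. p v)"
    using assms unfolding conj_represented_def by auto
  have "pred_rel xs (\<lambda>v. \<forall>p\<in>\<P>. p v) \<in> EO_conj k G" using \<P>(1-4)
  proof (induction \<P> rule: finite_ne_induct)
    case (singleton p)
    then show ?case
      using assms represented_pred_rel by (auto simp: EO_conj_def intro!: generated.base)
  next
    case (insert p \<P>)
    let ?Q = "\<lambda>v. \<forall>q\<in>\<P>. q v" and ?A = "\<lambda>P. snd (pred_rel xs P)"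
    have dep: "depends_only (set xs) p" using insert.prems by blast
    have dep': "depends_only (set xs) ?Q" unfolding depends_only_def
    proof (intro allI impI)
      fix v w :: "var \<Rightarrow> bool" assume "\<forall>x\<in>set xs. v x = w x"
      then have "q v = q w" if "q \<in> \<P>" for q
        using insert.prems(2) that by (intro depends_onlyD[of "set xs" q]) auto
      then show "?Q v = ?Q w" by (metis (no_types))
    qed
    have "pred_rel xs (\<lambda>v. \<forall>q\<in>insert p \<P>. q v) = (map fst xs, ?A p \<inter> ?A ?Q)"
      using map_in_pred_rel[OF dep] map_in_pred_rel[OF dep'] assms(2)
      by (intro pred_rel_eqI) (auto simp: pred_rel_def)
    moreover have "pred_rel xs p \<in> EO_conj k G"
      using represented_pred_rel[OF _ dep assms(2,3)] insert.prems
      by (simp add: EO_conj_def generated.base)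
    ultimately show ?case
      using generated.step[OF _ elem_op.conj[of k "map fst xs" "?A p" "?A ?Q"], of "{6}" G] insert
      by (simp add: EO_conj_def pred_rel_def)
  qed
  moreover have "P = (\<lambda>v. \<forall>p\<in>\<P>. p v)" by (rule ext) (rule \<P>(5)[rule_format])
  ultimately show ?thesis by (simp only:)
qed

end

section \<open>Closure of the definable relations\<close>

lemma with_consts_srels: "S \<subseteq> srels k \<Longrightarrow> with_consts k S \<subseteq> srels k"
  by (auto simp: with_consts_def srels_def bot_rel_def eq_rel_def)

lemma eq_formula:
  assumes "fst x = fst y" "fst x \<in> {1..k}"
  shows "well_sorted k (with_consts k S) (Atom (eq_rel (fst x)) [x, y])"
    and "sat v (Atom (eq_rel (fst x)) [x, y]) \<longleftrightarrow> v x = v y"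
  using assms by (auto simp: with_consts_def eq_rel_def)

text \<open>Free variables are left unrestricted to keep the closure lemmas free of bookkeeping;
  \<open>eliminate_free_vars\<close> trims them afterwards.\<close>

definition expressible :: "nat \<Rightarrow> srel set \<Rightarrow> ((var \<Rightarrow> bool) \<Rightarrow> bool) set" where
  "expressible k S = {\<lambda>v. sat v \<phi> | \<phi>. well_sorted k (with_consts k S) \<phi>}"

lemma expressibleI:
  "well_sorted k (with_consts k S) \<phi> \<Longrightarrow> (\<lambda>v. sat v \<phi>) \<in> expressible k S"
  unfolding expressible_def by blast

lemma expressibleE:
  assumes "P \<in> expressible k S"
  obtains \<phi> where "well_sorted k (with_consts k S) \<phi>" "P = (\<lambda>v. sat v \<phi>)"
  using assms unfolding expressible_def by blast

lemma expressible_Conj: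
  assumes "P \<in> expressible k S" "Q \<in> expressible k S"
  shows "(\<lambda>v. P v \<and> Q v) \<in> expressible k S"
proof -
  obtain \<phi> \<psi> where "well_sorted k (with_consts k S) (Conj \<phi> \<psi>)"
      "P = (\<lambda>v. sat v \<phi>)" "Q = (\<lambda>v. sat v \<psi>)"
    using assms by (auto elim!: expressibleE)
  then show ?thesis using expressibleI[of k S "Conj \<phi> \<psi>"] by simp
qed

lemma expressible_Exists:
  assumes "P \<in> expressible k S" "fst x \<in> {1..k}"
  shows "(\<lambda>v. \<exists>b. P (v(x := b))) \<in> expressible k S"
proof -
  obtain \<phi> where "well_sorted k (with_consts k S) (Exists x \<phi>)" "P = (\<lambda>v. sat v \<phi>)"
    using assms by (auto elim!: expressibleE)
  then show ?thesis using expressibleI[of k S "Exists x \<phi>"] by simp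
qed

lemma expressible_Forall:
  assumes "P \<in> expressible k S" "fst x \<in> {1..k}"
  shows "(\<lambda>v. \<forall>b. P (v(x := b))) \<in> expressible k S"
proof -
  obtain \<phi> where "well_sorted k (with_consts k S) (Forall x \<phi>)" "P = (\<lambda>v. sat v \<phi>)"
    using assms by (auto elim!: expressibleE)
  then show ?thesis using expressibleI[of k S "Forall x \<phi>"] by simp
qed

lemma expressible_subst:
  assumes "P \<in> expressible k S" "fst x = fst y" "fst x \<in> {1..k}"
  shows "(\<lambda>v. P (v(x := v y))) \<in> expressible k S"
proof (cases "x = y")
  case True
  then show ?thesis using assms(1) by simp
next
  case False
  have "(\<lambda>v. v x = v y) \<in> expressible k S"
    using expressibleI[OF eq_formula(1)[OF assms(2,3)]] eq_formula(2)[OF assms(2,3)] by (simp only:)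
  from expressible_Exists[OF expressible_Conj[OF this assms(1)] assms(3)]
  \<comment> \<open>As \<open>x\<close> differs from \<open>y\<close>, updating \<open>x\<close>
    leaves \<open>v y\<close> intact, so the equality forces the bound value to be
    \<open>v y\<close>.\<close>
  show ?thesis using False by (simp cong: conj_cong)
qed

section \<open>Definable relations and expressible predicates\<close>

lemma qpp_srels:
  assumes "\<rho> \<in> qpp k S"
  shows "\<rho> \<in> srels k"
proof -
  obtain xs \<phi> where "\<rho> = defined_rel xs \<phi>" "fst ` set xs \<subseteq> {1..k}"
    using assms unfolding qpp_def mem_Collect_eq by blast
  then show ?thesis by (auto simp: defined_rel_def srels_def)
qed

text \<open>Membership in \<open>qpp\<close> gives a formula for one list \<open>xs\<close>, while
  \<open>zs\<close> may overlap \<open>xs\<close> and repeat variables. Since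
  \<open>replace_vars\<close> needs disjoint lists, \<open>xs\<close> is first moved to fresh
  \<open>ys\<close>, then \<open>ys\<close> to \<open>zs\<close>.\<close>

lemma qpp_expressible:
  assumes "(ss, A) \<in> qpp k S" "map fst zs = ss"
  shows "(\<lambda>v. map v zs \<in> A) \<in> expressible k S"
proof -
  obtain xs \<phi> where \<phi>: "well_sorted k (with_consts k S) \<phi>" "distinct xs" "fst ` set xs \<subseteq> {1..k}"
      "free_vars \<phi> \<subseteq> set xs" and A: "(ss, A) = pred_rel xs (\<lambda>v. sat v \<phi>)"
    using assms(1) unfolding qpp_def defined_rel_eq mem_Collect_eq by blast
  have ss: "map fst xs = ss" using A by (simp add: pred_rel_def)
  obtain ys :: "var list" where ys: "distinct ys" "map fst ys = ss" "set ys \<inter> (set xs \<union> set zs) = {}"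
    using fresh_vars[of "set xs \<union> set zs"] by auto
  have ys_k: "fst ` set ys \<subseteq> {1..k}" using \<phi>(3) ss ys(2) by (metis set_map)
  have "map v xs \<in> snd (pred_rel xs (\<lambda>v. sat v \<phi>)) \<longleftrightarrow> sat v \<phi>" for v
    by (rule map_in_pred_rel[OF depends_only_mono[OF depends_only_sat \<phi>(4)]])
  then have "(\<lambda>v. map v xs \<in> A) = (\<lambda>v. sat v \<phi>)"
    by (simp flip: A)
  then have "(\<lambda>v. map v xs \<in> A) \<in> expressible k S"
    using expressibleI[OF \<phi>(1)] by simp
  then have "(\<lambda>v. map v ys \<in> A) \<in> expressible k S"
    using replace_vars[of "expressible k S" "{1..k}" xs ys "[]" A] expressible_subst \<phi> ss ys
    by (auto simp: Int_Un_distrib Int_commute)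
  then show ?thesis
    using replace_vars[of "expressible k S" "{1..k}" ys zs "[]" A] expressible_subst ys ys_k assms(2)
    by (auto simp: Int_Un_distrib)
qed

lemma finite_free_vars: "finite (free_vars \<phi>)"
  by (induction \<phi>) auto

text \<open>Allows a free variable to be quantified: the sorts come from the relations in the
  atoms.\<close>

lemma free_vars_sorts:
  assumes "T \<subseteq> srels k" "well_sorted k T \<phi>" "x \<in> free_vars \<phi>"
  shows "fst x \<in> {1..k}"
  using assms(2,3)
proof (induction \<phi>)
  case (Atom \<rho> xs)
  then have "x \<in> set xs" by simp
  then have "fst x \<in> set (map fst xs)" by simp
  moreover have "map fst xs = fst \<rho>" "\<rho> \<in> srels k" using Atom assms(1) by auto
  ultimately have "fst x \<in> set (fst \<rho>)" "\<rho> \<in> srels k" by (simp_all only:)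
  then show ?case by (auto simp: srels_def)
qed auto

text \<open>A free variable that does not influence satisfaction can be bound by an existential
  quantifier without changing the meaning. Each such step lowers the number of surplus
  variables.\<close>

lemma eliminate_free_vars:
  assumes "T \<subseteq> srels k" "well_sorted k T \<phi>" "depends_only V (\<lambda>v. sat v \<phi>)"
  shows "\<exists>\<psi>. well_sorted k T \<psi> \<and> free_vars \<psi> \<subseteq> V \<and> (\<forall>v. sat v \<psi> \<longleftrightarrow> sat v \<phi>)"
  using assms(2,3)
proof (induction "card (free_vars \<phi> - V)" arbitrary: \<phi>)
  case 0
  then have "free_vars \<phi> \<subseteq> V" using finite_free_vars[of \<phi>] by auto
  then show ?case using 0 by blast
next
  case (Suc n)
  then obtain x where x: "x \<in> free_vars \<phi>" "x \<notin> V" by (metis Diff_iff all_not_in_conv card.empty nat.distinct(1))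
  have eq: "sat v (Exists x \<phi>) \<longleftrightarrow> sat v \<phi>" for v
    using depends_only_upd[OF Suc.prems(2) x(2)] by simp
  have "free_vars (Exists x \<phi>) - V = (free_vars \<phi> - V) - {x}" by auto
  then have "card (free_vars (Exists x \<phi>) - V) = n"
    using Suc.hyps(2) x finite_free_vars[of \<phi>] by simp
  moreover have "well_sorted k T (Exists x \<phi>)"
    using free_vars_sorts[OF assms(1) Suc.prems(1) x(1)] Suc.prems(1) by simp
  moreover have "depends_only V (\<lambda>v. sat v (Exists x \<phi>))" using Suc.prems(2) eq by presburger
  ultimately show ?case using Suc.hyps(1)[of "Exists x \<phi>"] eq by blast
qed

text \<open>The predicate reads only the values on \<open>zs\<close>, so surplus free variables of
  the formula can be bound. Definability is thus reduced to expressibility.\<close>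

lemma qppI:
  assumes "S \<subseteq> srels k" "(ss, A) \<in> srels k"
    and "\<And>zs. distinct zs \<Longrightarrow> map fst zs = ss \<Longrightarrow> (\<lambda>v. map v zs \<in> A) \<in> expressible k S"
  shows "(ss, A) \<in> qpp k S"
proof -
  obtain zs :: "var list" where zs: "distinct zs" "map fst zs = ss" using fresh_vars[of "{}"] by auto
  obtain \<phi> where \<phi>: "well_sorted k (with_consts k S) \<phi>" "(\<lambda>v. map v zs \<in> A) = (\<lambda>v. sat v \<phi>)"
    by (rule expressibleE[OF assms(3)[OF zs]])
  have "depends_only (set zs) (\<lambda>v. sat v \<phi>)" using depends_only_map[of zs A] by (simp only: \<phi>(2))
  then obtain \<psi> where \<psi>: "well_sorted k (with_consts k S) \<psi>" "free_vars \<psi> \<subseteq> set zs"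
      "\<And>v. sat v \<psi> \<longleftrightarrow> sat v \<phi>"
    using eliminate_free_vars[OF with_consts_srels[OF assms(1)] \<phi>(1)] by blast
  have "defined_rel zs \<psi> = (map fst zs, A)" unfolding defined_rel_eq
    using assms(2) zs \<psi>(3) \<phi>(2) by (intro pred_rel_eqI) (auto simp: srels_def fun_eq_iff)
  moreover have "fst ` set zs \<subseteq> {1..k}" using assms(2) by (simp add: srels_def flip: zs(2))
  ultimately show ?thesis unfolding qpp_def mem_Collect_eq using zs \<psi>(1,2)
    by (intro exI[of _ zs] exI[of _ \<psi>]) simp
qed

section \<open>Definability is preserved by the elementary operations\<close>

lemma remove_nth_map: "remove_nth i (map f xs) = map f (remove_nth i xs)"
  by (simp add: remove_nth_def take_map drop_map)

lemma length_remove_nth: "i < length xs \<Longrightarrow> length (remove_nth i xs) = length xs - 1"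
  by (simp add: remove_nth_def)

lemma set_remove_nth: "set (remove_nth i xs) \<subseteq> set xs"
  by (auto simp: remove_nth_def dest: in_set_takeD in_set_dropD)

text \<open>Turns equality after deletion into the list update by which \<open>dummy\<close> is
  defined.\<close>

lemma remove_nth_eq:
  assumes "length a = length b" "i < length a" "remove_nth i a = remove_nth i b"
  shows "a = b[i := a ! i]"
proof -
  have "take i a @ drop (Suc i) a = take i b @ drop (Suc i) b"
    using assms(3) by (simp only: remove_nth_def)
  moreover have "length (take i a) = length (take i b)" using assms(1) by simp
  ultimately have *: "take i a = take i b" "drop (Suc i) a = drop (Suc i) b"
    by (metis append_eq_append_conv)+
  have "a = take i a @ a ! i # drop (Suc i) a" using assms(2) by (rule id_take_nth_drop)
  also have "\<dots> = b[i := a ! i]"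
    using assms(1,2) unfolding * by (simp add: upd_conv_take_nth_drop)
  finally show ?thesis .
qed

lemma permute_list_inv:
  assumes "\<pi> permutes {..<n}" "length as = n"
  shows "permute_list (inv \<pi>) (permute_list \<pi> as) = as"
    and "permute_list \<pi> (permute_list (inv \<pi>) as) = as"
  using permute_list_compose[of "inv \<pi>" as \<pi>] permute_list_compose[of \<pi> as "inv \<pi>"]
    permutes_inv[OF assms(1)] permutes_inv_o[OF assms(1)] assms by simp_all

text \<open>For given variables \<open>zs\<close> of the result, suitable variables of the operands
  are found; \<open>qpp_expressible\<close> accepts any lists of matching sorts, with
  repetitions.\<close>

lemma qpp_elem_op:
  assumes S: "S \<subseteq> srels k" and "elem_op k j \<rho>s \<rho>" "set \<rho>s \<subseteq> qpp k S"
  shows "\<rho> \<in> qpp k S"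
  using assms(2,3)
proof (induction rule: elem_op.induct)
  case (append_dummy s ss A)
  then have A: "(ss, A) \<in> qpp k S" by simp
  let ?B = "{a @ [b] | a b. a \<in> A}"
  show ?case
  proof (rule qppI[OF S])
    show "(ss @ [s], ?B) \<in> srels k" using qpp_srels[OF A] append_dummy by (auto simp: srels_def)
    fix zs :: "var list" assume "map fst zs = ss @ [s]"
    then obtain ys z where zs: "zs = ys @ [z]" "map fst ys = ss"
      by (auto simp: map_eq_append_conv)
    then have "map v zs \<in> ?B \<longleftrightarrow> map v ys \<in> A" for v :: "var \<Rightarrow> bool" by auto
    then show "(\<lambda>v. map v zs \<in> ?B) \<in> expressible k S" using qpp_expressible[OF A zs(2)] by simp
  qed
next
  case (remove_dummy i ss A)
  then have A: "(ss, A) \<in> qpp k S" by simp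
  have len: "length a = length ss" if "a \<in> A" for a
    using qpp_srels[OF A] that by (auto simp: srels_def)
  have i: "i < length ss" using remove_dummy by (simp add: dummy_def)
  let ?B = "remove_nth i ` A"
  show ?case
  proof (rule qppI[OF S])
    show "(remove_nth i ss, ?B) \<in> srels k"
    proof -
      have "set ss \<subseteq> {1..k}" using qpp_srels[OF A] by (simp add: srels_def)
      then have "set (remove_nth i ss) \<subseteq> {1..k}" using set_remove_nth by (rule order_trans[rotated])
      then show ?thesis using i len by (simp add: srels_def length_remove_nth)
    qed
    fix zs :: "var list" assume zs: "map fst zs = remove_nth i ss"
    then have lz: "length zs = length ss - 1" using length_remove_nth[OF i] by (metis length_map)
    \<comment> \<open>The name \<open>0\<close> is arbitrary and may already occur in
      \<open>zs\<close>: position \<open>i\<close> is dummy, so the value put there does not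
      matter.\<close>
    let ?ys = "take i zs @ (ss ! i, 0) # drop i zs"
    have ys: "remove_nth i ?ys = zs" using lz i by (simp add: remove_nth_def)
    have "map fst ?ys = take i (map fst zs) @ ss ! i # drop i (map fst zs)"
      by (simp add: take_map drop_map)
    also have "\<dots> = ss" using i unfolding zs by (simp add: remove_nth_def id_take_nth_drop[symmetric])
    finally have fst_ys: "map fst ?ys = ss" .
    have "map v zs \<in> ?B \<longleftrightarrow> map v ?ys \<in> A" for v :: "var \<Rightarrow> bool"
    proof
      assume "map v zs \<in> ?B"
      then obtain a where a: "a \<in> A" "remove_nth i (map v ?ys) = remove_nth i a"
        using ys by (metis imageE remove_nth_map)
      moreover have "length (map v ?ys) = length ss" using fst_ys by (metis length_map)
      ultimately have "map v ?ys = a[i := map v ?ys ! i]"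
        using i len by (intro remove_nth_eq) auto
      then show "map v ?ys \<in> A" using remove_dummy(1) a(1) len[OF a(1)] unfolding dummy_def by (metis fst_conv snd_conv)
    next
      assume "map v ?ys \<in> A"
      then show "map v zs \<in> ?B" using ys remove_nth_map by (metis imageI)
    qed
    then show "(\<lambda>v. map v zs \<in> ?B) \<in> expressible k S" using qpp_expressible[OF A fst_ys] by simp
  qed
next
  case (permute \<pi> ss A)
  then have A: "(ss, A) \<in> qpp k S" by simp
  have len: "length a = length ss" if "a \<in> A" for a
    using qpp_srels[OF A] that by (auto simp: srels_def)
  let ?B = "permute_list \<pi> ` A"
  have inv: "inv \<pi> permutes {..<length ss}" using permute(1) by (rule permutes_inv)
  show ?case
  proof (rule qppI[OF S])
    show "(permute_list \<pi> ss, ?B) \<in> srels k"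
      using qpp_srels[OF A] permute(1) by (auto simp: srels_def)
    fix zs :: "var list" assume zs: "map fst zs = permute_list \<pi> ss"
    then have lz: "length zs = length ss" by (metis length_map length_permute_list)
    \<comment> \<open>The inverse permutation restores the order of the operand's variables.\<close>
    let ?ys = "permute_list (inv \<pi>) zs"
    have "map v zs \<in> ?B \<longleftrightarrow> map v ?ys \<in> A" for v :: "var \<Rightarrow> bool"
    proof -
      have "map v ?ys = permute_list (inv \<pi>) (map v zs)"
        using inv lz by (simp add: permute_list_map)
      then show ?thesis
        using permute_list_inv[OF permute(1)] len lz by (metis image_iff length_map)
    qed
    moreover have "map fst ?ys = ss"
      using inv lz zs permute_list_inv(1)[OF permute(1) refl] by (simp flip: permute_list_map)
    ultimately show "(\<lambda>v. map v zs \<in> ?B) \<in> expressible k S" using qpp_expressible[OF A] by simp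
  qed
next
  case (identify s ss A)
  then have A: "(s # s # ss, A) \<in> qpp k S" by simp
  let ?B = "{x # xs | x xs. x # x # xs \<in> A}"
  show ?case
  proof (rule qppI[OF S])
    show "(s # ss, ?B) \<in> srels k" using qpp_srels[OF A] by (auto simp: srels_def)
    fix zs :: "var list" assume "map fst zs = s # ss"
    \<comment> \<open>Using \<open>z\<close> twice in the operand expresses the
      identification.\<close>
    then obtain z ys where zs: "zs = z # ys" "map fst (z # z # ys) = s # s # ss" by auto
    then have "map v zs \<in> ?B \<longleftrightarrow> map v (z # z # ys) \<in> A" for v :: "var \<Rightarrow> bool" by auto
    then show "(\<lambda>v. map v zs \<in> ?B) \<in> expressible k S" using qpp_expressible[OF A zs(2)] by simp
  qed
next
  case (compose s ss A ts B)
  then have AB: "(s # ss, A) \<in> qpp k S" "(s # ts, B) \<in> qpp k S" by auto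
  let ?C = "{xs @ ys | xs ys. \<exists>z. z # xs \<in> A \<and> z # ys \<in> B}"
  have s: "s \<in> {1..k}" using qpp_srels[OF AB(1)] by (auto simp: srels_def)
  have len: "length a = length ss" if "z # a \<in> A" for z a
    using qpp_srels[OF AB(1)] that by (auto simp: srels_def)
  show ?case
  proof (rule qppI[OF S])
    show "(ss @ ts, ?C) \<in> srels k"
      using qpp_srels[OF AB(1)] qpp_srels[OF AB(2)] by (fastforce simp: srels_def)
    fix zs :: "var list" assume "map fst zs = ss @ ts"
    then obtain xs ys where zs: "zs = xs @ ys" "map fst xs = ss" "map fst ys = ts"
      by (auto simp: map_eq_append_conv)
    \<comment> \<open>A fresh variable serves as the common first variable of both operands and is
      then bound.\<close>
    obtain z :: var where z: "fst z = s" "z \<notin> set zs"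
      using fresh_vars[of "set zs" "[s]"] by auto
    have upd: "map (v(z := b)) (z # xs) = b # map v xs" "map (v(z := b)) (z # ys) = b # map v ys"
      for v :: "var \<Rightarrow> bool" and b using z zs(1) by auto
    have "(\<lambda>v. map v (z # xs) \<in> A \<and> map v (z # ys) \<in> B) \<in> expressible k S"
      using zs z by (intro expressible_Conj qpp_expressible[OF AB(1)] qpp_expressible[OF AB(2)]) auto
    from expressible_Exists[OF this, of z]
    have "(\<lambda>v. \<exists>b. b # map v xs \<in> A \<and> b # map v ys \<in> B) \<in> expressible k S"
      using s z unfolding upd by simp
    moreover have "map v zs \<in> ?C \<longleftrightarrow> (\<exists>b. b # map v xs \<in> A \<and> b # map v ys \<in> B)"
      for v :: "var \<Rightarrow> bool"
    proof
      assume "map v zs \<in> ?C"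
      then obtain as bs b where *: "map v xs @ map v ys = as @ bs" "b # as \<in> A" "b # bs \<in> B"
        unfolding zs by auto
      then have "length as = length xs" using len zs(2) by (metis length_map)
      then show "\<exists>b. b # map v xs \<in> A \<and> b # map v ys \<in> B" using * by auto
    qed (auto simp: zs)
    ultimately show "(\<lambda>v. map v zs \<in> ?C) \<in> expressible k S" by simp
  qed
next
  case (forall s ss A)
  then have A: "(s # ss, A) \<in> qpp k S" by simp
  have s: "s \<in> {1..k}" using qpp_srels[OF A] by (auto simp: srels_def)
  let ?B = "{xs. \<forall>y. y # xs \<in> A}"
  show ?case
  proof (rule qppI[OF S])
    show "(ss, ?B) \<in> srels k" using qpp_srels[OF A] by (force simp: srels_def)
    fix zs :: "var list" assume zs: "map fst zs = ss"
    obtain z :: var where z: "fst z = s" "z \<notin> set zs"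
      using fresh_vars[of "set zs" "[s]"] by auto
    have upd: "map (v(z := b)) (z # zs) = b # map v zs" for v :: "var \<Rightarrow> bool" and b
      using z by auto
    have "(\<lambda>v. map v (z # zs) \<in> A) \<in> expressible k S"
      using zs z by (intro qpp_expressible[OF A]) auto
    from expressible_Forall[OF this, of z]
    show "(\<lambda>v. map v zs \<in> ?B) \<in> expressible k S" using s z unfolding upd by simp
  qed
next
  case (conj ss A B)
  then have AB: "(ss, A) \<in> qpp k S" "(ss, B) \<in> qpp k S" by auto
  show ?case
  proof (rule qppI[OF S])
    show "(ss, A \<inter> B) \<in> srels k" using qpp_srels[OF AB(1)] by (auto simp: srels_def)
    fix zs :: "var list" assume "map fst zs = ss"
    then show "(\<lambda>v. map v zs \<in> A \<inter> B) \<in> expressible k S"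
      using expressible_Conj qpp_expressible[OF AB(1)] qpp_expressible[OF AB(2)] by simp
  qed
qed

section \<open>The inclusions between the three sets of relations\<close>

lemma with_consts_qpp:
  assumes "S \<subseteq> srels k" "\<rho> \<in> with_consts k S"
  shows "\<rho> \<in> qpp k S"
proof -
  obtain ss A where \<rho>: "\<rho> = (ss, A)" by (cases \<rho>)
  have "(ss, A) \<in> qpp k S"
  proof (rule qppI[OF assms(1)])
    show "(ss, A) \<in> srels k" using assms with_consts_srels \<rho> by blast
    fix zs :: "var list" assume "map fst zs = ss"
    then have "well_sorted k (with_consts k S) (Atom \<rho> zs)" using assms(2) \<rho> by simp
    then show "(\<lambda>v. map v zs \<in> A) \<in> expressible k S"
      using expressibleI[of k S "Atom \<rho> zs"] \<rho> by simp
  qed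
  then show ?thesis using \<rho> by simp
qed

lemma EO_subset_qpp:
  assumes "S \<subseteq> srels k"
  shows "EO k i S \<subseteq> qpp k S"
proof
  fix \<rho> assume "\<rho> \<in> EO k i S"
  then show "\<rho> \<in> qpp k S" unfolding EO_def
  proof (induction rule: generated.induct)
    case (base \<rho>)
    then show ?case using assms with_consts_qpp by blast
  next
    case (step j \<rho>s \<rho>)
    then show ?case using qpp_elem_op[OF assms] by blast
  qed
qed

lemma qpp_subset_EO_conj:
  assumes "S \<subseteq> srels k"
  shows "qpp k S \<subseteq> EO_conj k (EO k 5 S)"
proof
  fix \<rho> assume "\<rho> \<in> qpp k S"
  then obtain xs \<phi> where \<phi>: "\<rho> = pred_rel xs (\<lambda>v. sat v \<phi>)" "well_sorted k (with_consts k S) \<phi>"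
      "distinct xs" "fst ` set xs \<subseteq> {1..k}" "free_vars \<phi> \<subseteq> set xs"
    unfolding qpp_def defined_rel_eq by auto
  interpret op_closed k "EO k 5 S"
    by unfold_locales (auto simp: EO_def intro: generated.step)
  have "with_consts k S \<subseteq> EO k 5 S" by (auto simp: EO_def intro: generated.base)
  then have "conj_represented (free_vars \<phi>) (\<lambda>v. sat v \<phi>)"
    using conj_represented_sat with_consts_srels[OF assms] \<phi>(2) by blast
  then have "conj_represented (set xs) (\<lambda>v. sat v \<phi>)"
    using \<phi>(5) by (rule conj_represented_mono)
  then show "\<rho> \<in> EO_conj k (EO k 5 S)" unfolding \<phi>(1) using \<phi>(3,4) by (rule pred_rel_EO_conj)
qed

text \<open>The second hypothesis lets \<open>T\<close> consist of generated relations, which covers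
  nested closures such as \<open>EO_conj k (EO k 5 S)\<close>.\<close>

lemma generated_mono:
  assumes "J \<subseteq> J'" "T \<subseteq> generated k J' T'"
  shows "generated k J T \<subseteq> generated k J' T'"
proof
  fix \<rho> assume "\<rho> \<in> generated k J T"
  then show "\<rho> \<in> generated k J' T'"
  proof (induction rule: generated.induct)
    case (base \<rho>)
    then show ?case using assms(2) by blast
  next
    case (step j \<rho>s \<rho>)
    then have "j \<in> J'" "\<forall>\<sigma>\<in>set \<rho>s. \<sigma> \<in> generated k J' T'" using assms(1) by auto
    then show ?case using step(2) by (intro generated.step)
  qed
qed

lemma EO_conj_subset_EO: "EO_conj k (EO k 5 S) \<subseteq> EO k 6 S"
proof -
  have "EO k 5 S \<subseteq> EO k 6 S"
    unfolding EO_def by (rule generated_mono) (auto intro: generated.base)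
  then show ?thesis unfolding EO_conj_def EO_def by (rule generated_mono[rotated]) auto
qed

theorem theorem4p3:
  fixes k :: nat and S :: "srel set"
  assumes "S \<subseteq> srels k"
  shows "qpp k S = EO k 6 S \<and> EO k 6 S = EO_conj k (EO k 5 S)"
  \<comment> \<open>The three inclusions form a cycle.\<close>
  using EO_subset_qpp[OF assms, of 6] qpp_subset_EO_conj[OF assms] EO_conj_subset_EO[of k S]
  by blast

end
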